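(* For all integers $1\le d\le n$ with $d$ even, the $(n,d)$ Delsarte linear program has an optimum $A^E$ whose Krawtchouk decomposition $b^E=(b_0^E,\dots,b_n^E)$ satisfies $b_j^E=b_{n-j}^E$ for all $0\le j\le n$.
   Context: $[a]=\{1,\dots,a\}$ (empty if $a\le 0$). $\binom{a}{b}=0$ unless $0\le b\le a$. For $0\le i,j\le n$, the Krawtchouk polynomial is $K_j(i)=K_j(i;n)=\sum_{k=0}^j(-1)^k\binom{i}{k}\binom{n-i}{j-k}$. For integers $1\le d\le n$, the $(n,d)$ Delsarte linear program, in real variables $A=(A_0,\dots,A_n)$, is: maximize $\sum_{i=0}^n A_i$ subject to $\sum_{i=0}^n A_iK_j(i)\ge 0$ for all $j\in[n]$; $A_i=0$ for all $i\in[d-1]$; $A_0=1$; $A_i\ge 0$ for all $i\in[n]$. An optimum is a feasible point achieving the optimal objective value. The Krawtchouk decomposition of a feasible point $A$ is the vector $b=(b_0,\dots,b_n)$ with $b_j=\frac{1}{\binom{n}{j}}\sum_{i=0}^n A_iK_j(i)$; equivalently $A_i=\binom{n}{i}\left(\sum_{j=0}^n b_jK_j(i)\right)/2^n$ for all $0\le i\le n$. *)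

theory Defs
  imports Complex_Main
begin

text \<open>
  A vector \<open>(A\<^sub>0, \<dots>, A\<^sub>n)\<close> is a function of type \<open>nat \<Rightarrow> real\<close> of which only the values at
  arguments up to \<open>n\<close> matter.
\<close>

text \<open>\<open>krawtchouk n j i\<close> is $K_j(i;n)$; it is only meaningful for \<open>i \<le> n\<close>, as \<open>n - i\<close> is truncated.\<close>

definition krawtchouk :: "nat \<Rightarrow> nat \<Rightarrow> nat \<Rightarrow> real" where
  "krawtchouk n j i = (\<Sum>k=0..j. (-1) ^ k * real (i choose k) * real ((n - i) choose (j - k)))"

definition delsarte_feasible :: "nat \<Rightarrow> nat \<Rightarrow> (nat \<Rightarrow> real) \<Rightarrow> bool" where
  "delsarte_feasible n d A \<longleftrightarrow>
     (\<forall>j\<in>{1..n}. (\<Sum>i=0..n. A i * krawtchouk n j i) \<ge> 0) \<and>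
     (\<forall>i\<in>{1..d - 1}. A i = 0) \<and>
     A 0 = 1 \<and>
     (\<forall>i\<in>{1..n}. A i \<ge> 0)"

definition delsarte_objective :: "nat \<Rightarrow> (nat \<Rightarrow> real) \<Rightarrow> real" where
  "delsarte_objective n A = (\<Sum>i=0..n. A i)"

definition delsarte_optimum :: "nat \<Rightarrow> nat \<Rightarrow> (nat \<Rightarrow> real) \<Rightarrow> bool" where
  "delsarte_optimum n d A \<longleftrightarrow>
     delsarte_feasible n d A \<and>
     (\<forall>B. delsarte_feasible n d B \<longrightarrow> delsarte_objective n B \<le> delsarte_objective n A)"

definition krawtchouk_decomposition :: "nat \<Rightarrow> (nat \<Rightarrow> real) \<Rightarrow> nat \<Rightarrow> real" where
  "krawtchouk_decomposition n A j =
     1 / real (n choose j) * (\<Sum>i=0..n. A i * krawtchouk n j i)"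

end

theory Submission
  imports Defs "HOL-Computational_Algebra.Polynomial" "HOL-Analysis.Function_Topology"
begin

text \<open>
  The symmetry \<open>b\<^sub>j = b\<^sub>n\<^sub>-\<^sub>j\<close> holds for every \<open>A\<close> supported on even indices, since
  \<open>K\<^sub>n\<^sub>-\<^sub>j(i) = (-1)\<^sup>i K\<^sub>j(i)\<close> (lemma \<open>krawtchouk_reflect\<close>).  So it suffices to turn an arbitrary
  optimum into one with even support, without leaving the feasible region or changing the objective.

  For codes of even minimum distance, this is done by puncturing a coordinate and appending a parity
  bit instead.  Averaged over the \<open>n\<close> coordinates, a word of odd weight \<open>i\<close> becomes one of
  weight \<open>i - 1\<close> in \<open>i\<close> of the \<open>n\<close> cases and one of weight \<open>i + 1\<close> in the others, while words of
  even weight keep their weight.  On the level of weight distributions, this is the Markov kernel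
  \<open>parity_kernel\<close> below, which makes sense for any real vector \<open>A\<close>.
  As \<open>d\<close> is even, an odd \<open>i \<ge> d\<close> has \<open>i - 1 \<ge> d\<close>, so the zero constraints survive.  The functions
  \<open>K\<^sub>j\<close> are eigenvectors of the random walk \<open>i \<mapsto> i \<plusminus> 1\<close> with eigenvalue \<open>1 - 2j/n\<close>
  (lemma \<open>krawtchouk_neighbours\<close>).  Hence, if \<open>e\<close> and \<open>o\<close> are the even and odd parts of
  \<open>\<Sum>\<^sub>i A\<^sub>i K\<^sub>j(i)\<close>, the new value is \<open>e + (1 - 2j/n) o\<close>, a convex combination of \<open>e + o\<close> and
  \<open>e - o\<close>; these are the old values at \<open>j\<close> and at \<open>n - j\<close>, and both are nonnegative.

  An optimum exists by compactness: \<open>\<Sum>\<^sub>j K\<^sub>j(i)\<close> is \<open>2\<^sup>n\<close> at \<open>i = 0\<close> and vanishes elsewhere, so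
  the sums \<open>\<Sum>\<^sub>i A\<^sub>i K\<^sub>j(i)\<close> for \<open>j = 0, \<dots>, n\<close>, all of them nonnegative, add up to \<open>2\<^sup>n\<close>.
  The one for \<open>j = 0\<close> is the objective, as \<open>K\<^sub>0 = 1\<close>; hence the objective, and with it each
  \<open>A\<^sub>i\<close>, is at most \<open>2\<^sup>n\<close>.
\<close>

section \<open>Krawtchouk polynomials\<close>

text \<open>
  In terms of the generating polynomial \<open>\<Sum>\<^sub>j K\<^sub>j(i) x\<^sup>j = (1 - x)\<^sup>i (1 + x)\<^sup>n\<^sup>-\<^sup>i\<close>, the identities
  below come from its reversal, its value at \<open>1\<close> and its derivative.
\<close>

definition krawtchouk_gf :: "nat \<Rightarrow> nat \<Rightarrow> real poly" where
  "krawtchouk_gf n i = [:1, -1:] ^ i * [:1, 1:] ^ (n - i)"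

lemma coeff_binomial_power: "coeff ([:1, c:] ^ m) k = of_nat (m choose k) * c ^ k"
  for c :: "'a::comm_semiring_1"
proof (cases "k \<le> m")
  case False
  have "degree ([:1, c:] ^ m) \<le> m"
    using degree_power_le [of "[:1, c:]" m] by (rule order_trans) simp
  with False show ?thesis
    by (simp add: coeff_eq_0 binomial_eq_0)
qed (simp add: coeff_linear_poly_power)

lemma krawtchouk_eq_coeff: "krawtchouk n j i = coeff (krawtchouk_gf n i) j"
  unfolding krawtchouk_def krawtchouk_gf_def coeff_mult
  by (simp add: coeff_binomial_power atMost_atLeast0 algebra_simps)

lemma degree_krawtchouk_gf: "i \<le> n \<Longrightarrow> degree (krawtchouk_gf n i) = n"
  unfolding krawtchouk_gf_def by (subst degree_mult_eq) (simp_all add: degree_power_eq)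

lemma krawtchouk_0_left [simp]: "krawtchouk n 0 i = 1"
  by (simp add: krawtchouk_def)

lemma krawtchouk_0_right [simp]: "krawtchouk n j 0 = real (n choose j)"
  by (simp add: krawtchouk_eq_coeff krawtchouk_gf_def coeff_binomial_power)

text \<open>Reversing the coefficients fixes \<open>1 + x\<close> and negates \<open>1 - x\<close>.\<close>

lemma krawtchouk_reflect:
  assumes "i \<le> n" "j \<le> n"
  shows "krawtchouk n (n - j) i = (-1) ^ i * krawtchouk n j i"
proof -
  have m: "reflect_poly [:1, -1::real:] = smult (-1) [:1, -1:]"
    and p: "reflect_poly [:1, 1::real:] = [:1, 1:]"
    by (simp_all add: reflect_poly_def)
  have "reflect_poly (krawtchouk_gf n i) = smult ((-1) ^ i) (krawtchouk_gf n i)"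
    unfolding krawtchouk_gf_def reflect_poly_mult reflect_poly_power m p smult_power
    by simp
  moreover have "coeff (reflect_poly (krawtchouk_gf n i)) j = coeff (krawtchouk_gf n i) (n - j)"
    using assms by (simp add: coeff_reflect_poly degree_krawtchouk_gf)
  ultimately show ?thesis
    by (simp add: krawtchouk_eq_coeff)
qed

lemma sum_krawtchouk:
  assumes "i \<le> n"
  shows "(\<Sum>j=0..n. krawtchouk n j i) = (if i = 0 then 2 ^ n else 0)"
proof -
  have "(\<Sum>j=0..n. krawtchouk n j i) = poly (krawtchouk_gf n i) 1"
    using assms by (simp add: poly_altdef degree_krawtchouk_gf krawtchouk_eq_coeff atLeast0AtMost)
  then show ?thesis
    by (simp add: krawtchouk_gf_def)
qed

text \<open>
  Flipping one of the \<open>n\<close> coordinates of a word of weight \<open>i\<close> lowers the weight in \<open>i\<close> cases and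
  raises it in \<open>n - i\<close> cases, so this says that \<open>K\<^sub>j\<close>, as a function of the weight, is an eigenvector
  of the Hamming graph.  It is the coefficient form of the differential equation
  \<open>i P\<^sub>i\<^sub>-\<^sub>1 + (n - i) P\<^sub>i\<^sub>+\<^sub>1 = n P\<^sub>i - 2 x P\<^sub>i'\<close> for \<open>P\<^sub>i = (1 - x)\<^sup>i (1 + x)\<^sup>n\<^sup>-\<^sup>i\<close>.
\<close>

lemma krawtchouk_neighbours:
  assumes "1 \<le> i" "i \<le> n"
  shows "real i * krawtchouk n j (i - 1) + (real n - real i) * krawtchouk n j (i + 1) =
    (real n - 2 * real j) * krawtchouk n j i"
proof -
  define u v :: "real poly" where "u = [:1, -1:]" and "v = [:1, 1:]"
  obtain a where a: "i = Suc a"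
    using assms by (cases i) auto
  obtain m where n: "n = Suc a + m"
    using assms a le_Suc_ex by blast
  define c e :: "real poly" where "c = of_nat (Suc a)" and "e = of_nat m"
  \<comment> \<open>\<open>w\<close> is the derivative of \<open>v\<^sup>m\<close>, and zero for \<open>m = 0\<close>.\<close>
  define w where "w = e * v ^ (m - 1)"
  have wv: "e * v ^ m = w * v"
    by (cases m) (simp_all add: w_def e_def)
  have P: "krawtchouk_gf n (i - 1) = u ^ a * v ^ m * v"
    "krawtchouk_gf n i = u ^ a * u * v ^ m"
    "krawtchouk_gf n (i + 1) = u ^ a * u * u * v ^ (m - 1)"
    by (simp_all add: krawtchouk_gf_def a n u_def v_def mult_ac del: mult_pCons_left mult_pCons_right)
  have "pderiv (u ^ Suc a) = - (c * u ^ a)" "pderiv (v ^ m) = w"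
    by (simp_all add: pderiv_power pderiv_power_Suc u_def v_def w_def c_def e_def pderiv_pCons
        of_nat_poly del: power_Suc of_nat_Suc)
  then have D: "pderiv (krawtchouk_gf n i) = u ^ a * u * w - c * u ^ a * v ^ m"
    unfolding P using pderiv_mult [of "u ^ Suc a" "v ^ m"] by (simp add: algebra_simps)
  have "c * krawtchouk_gf n (i - 1) + e * krawtchouk_gf n (i + 1) =
      c * u ^ a * v ^ m * v + u ^ a * u * u * w"
    unfolding P w_def by (simp add: algebra_simps)
  also have "\<dots> = c * krawtchouk_gf n i + u ^ a * u * (w * v) - (v - u) * pderiv (krawtchouk_gf n i)"
    unfolding D unfolding P(1,2) by (simp add: algebra_simps)
  also have "u ^ a * u * (w * v) = e * krawtchouk_gf n i"
    unfolding P wv [symmetric] by (simp add: algebra_simps)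
  also have "v - u = monom 2 1"
    by (simp add: u_def v_def monom_altdef)
  finally have "coeff (c * krawtchouk_gf n (i - 1) + e * krawtchouk_gf n (i + 1)) j =
      coeff (c * krawtchouk_gf n i + e * krawtchouk_gf n i
        - monom 2 1 * pderiv (krawtchouk_gf n i)) j"
    by simp
  moreover have "coeff (monom 2 1 * pderiv (krawtchouk_gf n i)) j = 2 * real j * krawtchouk n j i"
    by (cases j) (simp_all add: coeff_monom_mult coeff_pderiv krawtchouk_eq_coeff)
  ultimately show ?thesis
    by (simp add: krawtchouk_eq_coeff c_def e_def of_nat_poly a n algebra_simps)
qed

section \<open>Moving odd weights to even weights\<close>

text \<open>
  The second argument is the weight before puncturing a random coordinate and appending a parity
  bit, the third one the weight afterwards.
\<close>

definition parity_kernel :: "nat \<Rightarrow> nat \<Rightarrow> nat \<Rightarrow> real" where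
  "parity_kernel n i k =
     (if even i then of_bool (k = i)
      else real i / real n * of_bool (k = i - 1)
        + (real n - real i) / real n * of_bool (k = i + 1))"

definition move_to_even :: "nat \<Rightarrow> (nat \<Rightarrow> real) \<Rightarrow> nat \<Rightarrow> real" where
  "move_to_even n A k = (\<Sum>i=0..n. A i * parity_kernel n i k)"

lemma parity_kernel_nonneg: "i \<le> n \<Longrightarrow> 0 \<le> parity_kernel n i k"
  by (simp add: parity_kernel_def)

lemma parity_kernel_odd: "odd k \<Longrightarrow> parity_kernel n i k = 0"
  by (auto simp: parity_kernel_def elim: oddE)

lemma move_to_even_odd: "odd k \<Longrightarrow> move_to_even n A k = 0"
  by (simp add: move_to_even_def parity_kernel_odd)

lemma sum_parity_kernel_krawtchouk:
  assumes "i \<le> n"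
  shows "(\<Sum>k=0..n. parity_kernel n i k * krawtchouk n j k) =
    (if even i then 1 else 1 - 2 * real j / real n) * krawtchouk n j i"
proof (cases "even i")
  case True
  then show ?thesis
    using assms by (simp add: parity_kernel_def of_bool_def if_distrib [of "\<lambda>x. x * _"] cong: if_cong)
next
  case False
  then have i: "1 \<le> i" "0 < n"
    using assms by (auto elim: oddE)
  have "(\<Sum>k=0..n. parity_kernel n i k * krawtchouk n j k) =
      (\<Sum>k=0..n. if k = i - 1 then real i / real n * krawtchouk n j k else 0) +
      (\<Sum>k=0..n. if k = i + 1 then (real n - real i) / real n * krawtchouk n j k else 0)"
    unfolding sum.distrib [symmetric]
    using False by (intro sum.cong) (auto simp: parity_kernel_def)
  \<comment> \<open>For \<open>i = n\<close>, the index \<open>i + 1\<close> is out of range, but its weight vanishes.\<close>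
  also have "\<dots> = real i / real n * krawtchouk n j (i - 1)
      + (real n - real i) / real n * krawtchouk n j (i + 1)"
    using assms by (cases "i = n") auto
  also have "\<dots> = (real i * krawtchouk n j (i - 1)
      + (real n - real i) * krawtchouk n j (i + 1)) / real n"
    by (simp add: add_divide_distrib)
  also have "\<dots> = (1 - 2 * real j / real n) * krawtchouk n j i"
    using i by (simp only: krawtchouk_neighbours [OF i(1) assms]) (simp add: field_simps)
  finally show ?thesis
    using False by simp
qed

text \<open>
  By the reflection formula, the sums at \<open>j\<close> and \<open>n - j\<close> are the sum and the difference of an even
  and an odd part.  The kernel multiplies the odd part by \<open>1 - 2j/n = (1 - j/n) - j/n\<close>, which is the
  same as averaging the two sums with weights \<open>1 - j/n\<close> and \<open>j/n\<close>.
\<close>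

lemma move_to_even_transform:
  assumes "0 < n" "j \<le> n"
  shows "(\<Sum>k=0..n. move_to_even n A k * krawtchouk n j k) =
    (1 - real j / real n) * (\<Sum>i=0..n. A i * krawtchouk n j i) +
    real j / real n * (\<Sum>i=0..n. A i * krawtchouk n (n - j) i)"
proof -
  have "(\<Sum>k=0..n. move_to_even n A k * krawtchouk n j k) =
      (\<Sum>i=0..n. A i * (\<Sum>k=0..n. parity_kernel n i k * krawtchouk n j k))"
    unfolding move_to_even_def sum_distrib_right sum_distrib_left
    by (subst sum.swap) (simp add: mult.assoc)
  also have "\<dots> = (\<Sum>i=0..n. (1 - real j / real n) * (A i * krawtchouk n j i) +
      real j / real n * (A i * krawtchouk n (n - j) i))"
    using assms
    by (intro sum.cong refl)
      (simp add: sum_parity_kernel_krawtchouk krawtchouk_reflect, simp add: algebra_simps)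
  finally show ?thesis
    by (simp add: sum.distrib sum_distrib_left)
qed

lemma objective_eq_transform: "delsarte_objective n A = (\<Sum>i=0..n. A i * krawtchouk n 0 i)"
  by (simp add: delsarte_objective_def)

lemma feasible_nonneg: "delsarte_feasible n d A \<Longrightarrow> i \<le> n \<Longrightarrow> 0 \<le> A i"
  unfolding delsarte_feasible_def by (cases "i = 0") auto

lemma feasible_objective_nonneg: "delsarte_feasible n d A \<Longrightarrow> 0 \<le> delsarte_objective n A"
  unfolding delsarte_objective_def by (intro sum_nonneg) (auto intro: feasible_nonneg)

lemma feasible_transform_nonneg:
  assumes "delsarte_feasible n d A" "j \<le> n"
  shows "0 \<le> (\<Sum>i=0..n. A i * krawtchouk n j i)"
  using assms feasible_objective_nonneg [OF assms(1)]
  by (cases "j = 0") (auto simp: delsarte_feasible_def delsarte_objective_def)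

lemma objective_move_to_even:
  "0 < n \<Longrightarrow> delsarte_objective n (move_to_even n A) = delsarte_objective n A"
  unfolding objective_eq_transform by (simp only: move_to_even_transform) simp

text \<open>
  Evenness of \<open>d\<close> keeps the mass at odd \<open>i \<ge> d\<close> away from the indices below \<open>d\<close>, since
  \<open>i \<noteq> d\<close>.  As it also gives \<open>d \<ge> 2\<close>, there is no mass at \<open>1\<close> that could move to \<open>0\<close>.
\<close>

lemma move_to_even_feasible:
  assumes "delsarte_feasible n d A" "1 \<le> d" "d \<le> n" "even d"
  shows "delsarte_feasible n d (move_to_even n A)"
  unfolding delsarte_feasible_def
proof (intro conjI ballI)
  fix j assume "j \<in> {1..n}"
  then have "0 < n" "j \<le> n" "real j / real n \<le> 1"
    by auto
  then show "0 \<le> (\<Sum>k=0..n. move_to_even n A k * krawtchouk n j k)"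
    using assms(1) by (simp add: move_to_even_transform feasible_transform_nonneg)
next
  have A: "A i = 0" if "1 \<le> i" "i < d" for i
    using assms(1) that by (auto simp: delsarte_feasible_def)
  fix k assume k: "k \<in> {1..d - 1}"
  have "A i * parity_kernel n i k = 0" for i
  proof (cases "parity_kernel n i k = 0")
    case False
    then have "k = i \<or> odd i \<and> (k = i - 1 \<or> k = i + 1)"
      by (auto simp: parity_kernel_def split: if_splits)
    with k \<open>even d\<close> have "1 \<le> i \<and> i < d"
      by simp presburger
    then show ?thesis
      by (simp add: A)
  qed simp
  then show "move_to_even n A k = 0"
    unfolding move_to_even_def by (intro sum.neutral) blast
next
  have "A 1 = 0" "A 0 = 1"
    using assms by (auto simp: delsarte_feasible_def elim!: evenE)
  then have "A i * parity_kernel n i 0 = (if i = 0 then 1 else 0)" for i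
    by (cases "i = 1") (auto simp: parity_kernel_def)
  then show "move_to_even n A 0 = 1"
    by (simp add: move_to_even_def)
next
  fix k
  show "0 \<le> move_to_even n A k"
    unfolding move_to_even_def
    using assms(1) by (intro sum_nonneg mult_nonneg_nonneg)
      (auto intro: feasible_nonneg parity_kernel_nonneg)
qed

lemma decomposition_symmetric_if_even_support:
  assumes "\<And>i. odd i \<Longrightarrow> A i = 0" "j \<le> n"
  shows "krawtchouk_decomposition n A j = krawtchouk_decomposition n A (n - j)"
proof -
  have "A i * krawtchouk n (n - j) i = A i * krawtchouk n j i" if "i \<le> n" for i
    using assms that by (cases "even i") (auto simp: krawtchouk_reflect)
  then have "(\<Sum>i=0..n. A i * krawtchouk n (n - j) i) = (\<Sum>i=0..n. A i * krawtchouk n j i)"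
    by (intro sum.cong) auto
  then show ?thesis
    unfolding krawtchouk_decomposition_def
    using assms(2) by (simp add: binomial_symmetric [of j n])
qed

section \<open>Existence of an optimum\<close>

lemma feasible_objective_le:
  assumes "delsarte_feasible n d A"
  shows "delsarte_objective n A \<le> 2 ^ n"
proof -
  have "delsarte_objective n A \<le> (\<Sum>j=0..n. \<Sum>i=0..n. A i * krawtchouk n j i)"
    unfolding objective_eq_transform
    by (rule member_le_sum) (auto intro: feasible_transform_nonneg [OF assms])
  also have "\<dots> = (\<Sum>i=0..n. A i * (\<Sum>j=0..n. krawtchouk n j i))"
    unfolding sum_distrib_left by (rule sum.swap)
  also have "\<dots> = (\<Sum>i=0..n. if i = 0 then 2 ^ n else 0)"
    using assms by (intro sum.cong) (auto simp: sum_krawtchouk delsarte_feasible_def)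
  finally show ?thesis
    by simp
qed

text \<open>
  Replacing the values beyond \<open>n\<close> by zero preserves feasibility and the objective, so it is
  enough to search the cube \<open>[0, 2\<^sup>n]\<^sup>\<nat>\<close>, which is compact in the product topology.
\<close>

lemma optimum_exists: "\<exists>A. delsarte_optimum n d A"
proof -
  define Q where "Q = (UNIV :: nat set) \<rightarrow>\<^sub>E {0..2 ^ n :: real}"
  define F where "F = {A. delsarte_feasible n d A}"
  have "compact Q"
    using compactin_PiE [of "\<lambda>_. euclidean" "UNIV :: nat set" "\<lambda>_. {0..2 ^ n :: real}"]
    by (simp add: Q_def euclidean_product_topology)
  moreover have "closed F"
    unfolding F_def delsarte_feasible_def Ball_def
    by (intro closed_Collect_conj closed_Collect_all closed_Collect_imp open_Collect_const
        closed_Collect_le closed_Collect_eq continuous_intros continuous_on_product_coordinates)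
  ultimately have "compact (Q \<inter> F)"
    by blast
  moreover have "(\<lambda>i. of_bool (i = 0)) \<in> Q \<inter> F"
    by (auto simp: Q_def F_def delsarte_feasible_def of_bool_def if_distrib [of "\<lambda>x. x * _"]
        cong: if_cong)
  moreover have "continuous_on (Q \<inter> F) (delsarte_objective n)"
    unfolding delsarte_objective_def
    by (intro continuous_on_sum continuous_on_subset [OF continuous_on_product_coordinates]) simp
  ultimately obtain A where A: "A \<in> Q \<inter> F"
    and max: "\<And>B. B \<in> Q \<inter> F \<Longrightarrow> delsarte_objective n B \<le> delsarte_objective n A"
    using continuous_attains_sup [of "Q \<inter> F" "delsarte_objective n"] by blast
  have "delsarte_objective n B \<le> delsarte_objective n A" if B: "delsarte_feasible n d B" for B
  proof -
    define C where "C i = (if i \<le> n then B i else 0)" for i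
    have "delsarte_feasible n d C"
      using B by (auto simp: delsarte_feasible_def C_def)
    moreover have "C i \<in> {0..2 ^ n}" for i
    proof (cases "i \<le> n")
      case True
      have "B i \<le> delsarte_objective n B"
        unfolding delsarte_objective_def
        using True by (intro member_le_sum) (auto intro: feasible_nonneg [OF B])
      with feasible_objective_le [OF B] feasible_nonneg [OF B True] show ?thesis
        by (simp add: C_def)
    qed (simp add: C_def)
    ultimately have "delsarte_objective n C \<le> delsarte_objective n A"
      by (intro max) (simp add: Q_def F_def PiE_UNIV_domain)
    then show ?thesis
      by (simp add: delsarte_objective_def C_def)
  qed
  with A show ?thesis
    by (auto simp: delsarte_optimum_def F_def)
qed

section \<open>A symmetric optimum\<close>

theorem theorem4p3:
  fixes n d :: nat
  assumes "1 \<le> d" and "d \<le> n" and "even d"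
  shows "\<exists>A. delsarte_optimum n d A \<and>
           (\<forall>j\<le>n. krawtchouk_decomposition n A j = krawtchouk_decomposition n A (n - j))"
proof -
  obtain A where A: "delsarte_optimum n d A"
    using optimum_exists by blast
  have "delsarte_optimum n d (move_to_even n A)"
    using A assms move_to_even_feasible [of n d A] objective_move_to_even [of n A]
    by (simp add: delsarte_optimum_def)
  moreover have "\<forall>j\<le>n. krawtchouk_decomposition n (move_to_even n A) j =
      krawtchouk_decomposition n (move_to_even n A) (n - j)"
    by (intro allI impI decomposition_symmetric_if_even_support move_to_even_odd)
  ultimately show ?thesis
    by blast
qed

end
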